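(* Let $R$ be a finite chain ring with maximal ideal $\langle\gamma\rangle$, even index of nilpotency $e$ of $\gamma$, and residue field $K$ with $|K|=p^r$ ($p$ prime), so $|R|=p^{er}$. Let $n$ be a positive integer with $\gcd(n,p)=1$. Then there exists a non-trivial cyclic self-dual code of length $n$ over $R$ if and only if $(p^r)^i\not\equiv -1\pmod n$ for all positive integers $i$.
   Context: A finite chain ring is a finite commutative local ring whose ideals are linearly ordered; its maximal ideal is principal, generated by a nilpotent $\gamma$ whose nilpotency index is $e$, and $K=R/\langle\gamma\rangle$ is its residue field. A code of length $n$ over $R$ is an $R$-submodule of $R^n$; it is cyclic if closed under the cyclic shift $(c_0,\dots,c_{n-1})\mapsto(c_{n-1},c_0,\dots,c_{n-2})$. The dual is $C^\perp=\{u\in R^n:\sum u_iv_i=0\ \forall v\in C\}$ and $C$ is self-dual if $C=C^\perp$. When $e$ is even, $\gamma^{e/2}R^n$ (generated by $\gamma^{e/2}I_n$) is a self-dual cyclic code, called the trivial self-dual code; a non-trivial self-dual code is a self-dual code different from it. *)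

theory Defs
  imports Main "HOL-Number_Theory.Cong"
begin

definition is_ideal :: "'a::comm_ring_1 set \<Rightarrow> bool" where
  "is_ideal I \<longleftrightarrow> 0 \<in> I \<and> (\<forall>x\<in>I. \<forall>y\<in>I. x + y \<in> I) \<and> (\<forall>x\<in>I. \<forall>a. a * x \<in> I)"

definition chain_ring :: "'a::comm_ring_1 itself \<Rightarrow> bool" where
  "chain_ring _ \<longleftrightarrow> finite (UNIV :: 'a set) \<and> (0::'a) \<noteq> 1
     \<and> is_ideal {x::'a. \<not> x dvd 1}
     \<and> (\<forall>I J :: 'a set. is_ideal I \<longrightarrow> is_ideal J \<longrightarrow> I \<subseteq> J \<or> J \<subseteq> I)"

definition pideal :: "'a::comm_ring_1 \<Rightarrow> 'a set" where
  "pideal g = range (\<lambda>a. a * g)"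

definition residue_field :: "'a::comm_ring_1 \<Rightarrow> 'a set set" where
  "residue_field g = {(\<lambda>y. x + y) ` pideal g | x. True}"

definition words :: "nat \<Rightarrow> (nat \<Rightarrow> 'a::zero) set" where
  "words n = {c. \<forall>i\<ge>n. c i = 0}"

definition is_code :: "nat \<Rightarrow> (nat \<Rightarrow> 'a::comm_ring_1) set \<Rightarrow> bool" where
  "is_code n C \<longleftrightarrow> C \<subseteq> words n \<and> (\<lambda>_. 0) \<in> C
     \<and> (\<forall>u\<in>C. \<forall>v\<in>C. (\<lambda>i. u i + v i) \<in> C)
     \<and> (\<forall>u\<in>C. \<forall>a. (\<lambda>i. a * u i) \<in> C)"

definition cshift :: "nat \<Rightarrow> (nat \<Rightarrow> 'a::zero) \<Rightarrow> nat \<Rightarrow> 'a" where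
  "cshift n c = (\<lambda>i. if i < n then c ((i + n - 1) mod n) else 0)"

definition cyclic_code :: "nat \<Rightarrow> (nat \<Rightarrow> 'a::comm_ring_1) set \<Rightarrow> bool" where
  "cyclic_code n C \<longleftrightarrow> is_code n C \<and> (\<forall>c\<in>C. cshift n c \<in> C)"

definition dual_code :: "nat \<Rightarrow> (nat \<Rightarrow> 'a::comm_ring_1) set \<Rightarrow> (nat \<Rightarrow> 'a) set" where
  "dual_code n C = {u \<in> words n. \<forall>v\<in>C. (\<Sum>i<n. u i * v i) = 0}"

definition self_dual :: "nat \<Rightarrow> (nat \<Rightarrow> 'a::comm_ring_1) set \<Rightarrow> bool" where
  "self_dual n C \<longleftrightarrow> C = dual_code n C"

definition trivial_sd_code :: "nat \<Rightarrow> 'a::comm_ring_1 \<Rightarrow> nat \<Rightarrow> (nat \<Rightarrow> 'a) set" where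
  "trivial_sd_code n g e = (\<lambda>v. \<lambda>i. g ^ (e div 2) * v i) ` words n"

end

theory Submission
  imports Defs "HOL-Computational_Algebra.Polynomial"
begin

text \<open>
  Write \<open>q = p\<^sup>r\<close>, identify cyclic codes with ideals of \<open>A = R[x]/(x\<^sup>n - 1)\<close>, and let \<open>f\<^sup>*\<close> be
  the image of \<open>f\<close> under \<open>x \<mapsto> x\<^sup>-\<^sup>1\<close>; the inner product of two words is the constant coefficient
  of \<open>f g\<^sup>*\<close>. Modulo \<open>\<gamma>\<close>, Frobenius gives \<open>f\<^sup>Q = f(x\<^sup>Q)\<close> for every power \<open>Q\<close> of \<open>q\<close>.

  If \<open>Q \<equiv> -1 (mod n)\<close>, then \<open>f\<^sup>* = f\<^sup>Q\<close> modulo \<open>\<gamma>\<close> and \<open>f \<mapsto> f\<^sup>Q\<close> is an involution. For a self-dual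
  \<open>C\<close> and \<open>c = \<gamma>\<^sup>j u \<in> C\<close> with \<open>j < e/2\<close>, the relation \<open>c c\<^sup>* = 0\<close> forces \<open>u u\<^sup>* = u\<^bsup>Q+1\<^esup> = 0\<close> modulo
  \<open>\<gamma>\<close>, hence \<open>\<gamma> | u\<close>. So \<open>C\<close> lies in, and by duality equals, \<open>\<gamma>\<^bsup>e/2\<^esup>A\<close>.

  If \<open>-1\<close> is not a power of \<open>q\<close> modulo \<open>n\<close>, the sum \<open>s\<close> of all \<open>x\<^sup>h\<close> with \<open>h\<close> in the orbit of \<open>1\<close> under
  \<open>q\<close> satisfies \<open>s\<^sup>q = s\<close> and \<open>s\<^sup>* \<noteq> s\<close> modulo \<open>\<gamma>\<close>. Hence one of the idempotents \<open>E = 1 - (s - c)\<^bsup>q-1\<^esup>\<close>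
  is not fixed by \<open>*\<close>, and \<open>E (1 - E\<^sup>*)\<close> lifts to an idempotent \<open>\<epsilon> \<noteq> 0\<close> of \<open>A\<close> with \<open>\<epsilon> \<epsilon>\<^sup>* = 0\<close>.
  The ideal \<open>\<epsilon>A + \<gamma>\<^bsup>e/2\<^esup>(1 - \<epsilon> - \<epsilon>\<^sup>*)A\<close> is then a non-trivial self-dual code.
\<close>

section \<open>Polynomials modulo \<open>x\<^sup>n - 1\<close>\<close>

text \<open>The coefficient of \<open>x\<^sup>k\<close> in the image of \<open>f\<close> in \<open>R[x]/(x\<^sup>n - 1)\<close>, as an \<open>n\<close>-periodic function
  of \<open>k\<close>.\<close>
definition wrap :: "nat \<Rightarrow> 'a::comm_ring_1 poly \<Rightarrow> int \<Rightarrow> 'a" where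
  "wrap n f k = (\<Sum>j\<le>degree f. if int n dvd k - int j then coeff f j else 0)"

lemma wrap_0 [simp]: "wrap n 0 k = 0"
  unfolding wrap_def by (intro sum.neutral ballI) simp

text \<open>Multiplication by \<open>x\<close> moves coefficients up by one; this recursion drives
  the inductions on polynomials.\<close>

lemma wrap_pCons: "wrap n (pCons a f) k = (if int n dvd k then a else 0) + wrap n f (k - 1)"
proof (cases "f = 0")
  case True
  then show ?thesis using wrap_0[of n "k - 1"] by (simp add: wrap_def)
next
  case False
  have "(\<Sum>j\<le>degree f. if int n dvd k - int (Suc j) then coeff (pCons a f) (Suc j) else 0)
      = wrap n f (k - 1)"
    unfolding wrap_def by (intro sum.cong) (simp_all add: diff_diff_eq)
  then show ?thesis
    unfolding wrap_def[of n "pCons a f"] degree_pCons_eq[OF False] sum.atMost_Suc_shift by simp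
qed

lemma wrap_add: "wrap n (f + g) k = wrap n f k + wrap n g k"
proof (induction f g arbitrary: k rule: poly_induct2)
  case 0
  then show ?case by simp
next
  case (pCons a p b q)
  then show ?case by (simp add: wrap_pCons algebra_simps)
qed

lemma wrap_smult: "wrap n (smult a f) k = a * wrap n f k"
  by (induction f arbitrary: k) (simp_all add: wrap_pCons algebra_simps)

lemma wrap_minus: "wrap n (- f) k = - wrap n f k"
  using wrap_smult[of n "-1" f k] by simp

lemma wrap_diff: "wrap n (f - g) k = wrap n f k - wrap n g k"
  using wrap_add[of n f "-g" k] by (simp add: wrap_minus)

lemma wrap_sum: "wrap n (\<Sum>i\<in>A. f i) k = (\<Sum>i\<in>A. wrap n (f i) k)"
  by (induction A rule: infinite_finite_induct) (simp_all add: wrap_add)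

lemma wrap_monom: "wrap n (monom a m) k = (if int n dvd k - int m then a else 0)"
  by (induction m arbitrary: k) (auto simp: monom_0 monom_Suc wrap_pCons algebra_simps)

lemma wrap_periodic:
  assumes "int n dvd k - l"
  shows "wrap n f k = wrap n f l"
proof -
  have "int n dvd k - int j \<longleftrightarrow> int n dvd l - int j" for j
    using dvd_add_right_iff[OF assms, of "l - int j"] by simp
  then show ?thesis by (simp add: wrap_def)
qed

lemma wrap_mod: "wrap n f (k mod int n) = wrap n f k"
  by (rule wrap_periodic) (simp add: dvd_eq_mod_eq_0 mod_simps)

text \<open>Over a full period only one term moves: the one at \<open>-1\<close>, which periodicity
  identifies with the one at \<open>n - 1\<close>.\<close>

lemma sum_shift_periodic:
  fixes F :: "int \<Rightarrow> 'b::ab_group_add"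
  assumes "\<And>k l. int n dvd k - l \<Longrightarrow> F k = F l"
  shows "(\<Sum>i<n. F (int i - 1)) = (\<Sum>i<n. F (int i))"
proof (cases n)
  case (Suc m)
  have "F (-1) = F (int m)"
  proof (rule assms)
    have "- 1 - int m = - int n" by (simp add: Suc)
    then show "int n dvd - 1 - int m" by simp
  qed
  then have "(\<Sum>i<Suc m. F (int i - 1)) = F (int m) + (\<Sum>i<m. F (int i))"
    unfolding sum.lessThan_Suc_shift by simp
  then show ?thesis by (simp add: Suc add.commute)
qed simp

text \<open>The product of \<open>R[x]/(x^n - 1)\<close> is cyclic convolution. In the induction the
  constant term contributes only at \<open>i = 0\<close>, and the shift caused by \<open>x\<close>
  is absorbed by summing over a full period.\<close>

lemma wrap_mult:
  assumes "n > 0"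
  shows "wrap n (f * g) k = (\<Sum>i<n. wrap n f (int i) * wrap n g (k - int i))"
proof (induction f arbitrary: k)
  case 0
  then show ?case by simp
next
  case (pCons a f)
  have "(\<Sum>i<n. wrap n (pCons a f) (int i) * wrap n g (k - int i))
      = (\<Sum>i<n. (if i = 0 then a * wrap n g k else 0))
        + (\<Sum>i<n. wrap n f (int i - 1) * wrap n g (k - 1 - (int i - 1)))"
    unfolding sum.distrib[symmetric]
    by (rule sum.cong) (auto simp: wrap_pCons algebra_simps zdvd_not_zless)
  also have "(\<Sum>i<n. wrap n f (int i - 1) * wrap n g (k - 1 - (int i - 1)))
      = (\<Sum>i<n. wrap n f (int i) * wrap n g (k - 1 - int i))"
    by (rule sum_shift_periodic[where F = "\<lambda>i. wrap n f i * wrap n g (k - 1 - i)"],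
        rule arg_cong2[where f = times])
      (auto intro!: wrap_periodic simp: algebra_simps dvd_diff_commute)
  finally show ?case
    using assms pCons.IH[of "k - 1"] by (simp add: wrap_add wrap_smult wrap_pCons)
qed

text \<open>The polynomials whose image in \<open>R[x]/(x\<^sup>n - 1)\<close> is divisible by \<open>g\<close>; for \<open>g = 0\<close> this is the
  ideal generated by \<open>x\<^sup>n - 1\<close>.\<close>
definition wideal :: "nat \<Rightarrow> 'a::comm_ring_1 \<Rightarrow> 'a poly set" where
  "wideal n g = {f. \<forall>k. g dvd wrap n f k}"

lemma wideal_0_mem [simp]: "0 \<in> wideal n g"
  by (simp add: wideal_def)

lemma wideal_add: "f \<in> wideal n g \<Longrightarrow> f' \<in> wideal n g \<Longrightarrow> f + f' \<in> wideal n g"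
  by (simp add: wideal_def wrap_add)

lemma wideal_minus: "f \<in> wideal n g \<Longrightarrow> - f \<in> wideal n g"
  by (simp add: wideal_def wrap_minus)

lemma wideal_diff: "f \<in> wideal n g \<Longrightarrow> f' \<in> wideal n g \<Longrightarrow> f - f' \<in> wideal n g"
  by (simp add: wideal_def wrap_diff)

lemma wideal_mult:
  assumes "n > 0" "f \<in> wideal n g" "f' \<in> wideal n g'"
  shows "f * f' \<in> wideal n (g * g')"
  using assms by (auto simp: wideal_def wrap_mult intro!: dvd_sum mult_dvd_mono)

lemma wideal_1: "f \<in> wideal n 1"
  by (simp add: wideal_def)

lemma wideal_mult_left: "n > 0 \<Longrightarrow> f' \<in> wideal n g \<Longrightarrow> f * f' \<in> wideal n g"
  using wideal_mult[of n f 1 f' g] wideal_1[of f n] by simp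

lemma wideal_mult_right: "n > 0 \<Longrightarrow> f \<in> wideal n g \<Longrightarrow> f * f' \<in> wideal n g"
  using wideal_mult_left[of n f g f'] by (simp add: mult.commute)

lemma wideal_dvd_mono: "f \<in> wideal n g \<Longrightarrow> g' dvd g \<Longrightarrow> f \<in> wideal n g'"
  by (auto simp: wideal_def intro: dvd_trans)

lemma wideal_power:
  assumes "n > 0" "f \<in> wideal n g"
  shows "f ^ k \<in> wideal n (g ^ k)"
  by (induction k) (auto intro: wideal_1 wideal_mult assms)

lemma wideal_smult: "smult g f \<in> wideal n g"
  by (simp add: wideal_def wrap_smult)

section \<open>Congruence modulo \<open>x^n - 1\<close> and a ring element; \<open>g = 0\<close>
  means equality in the quotient\<close>

definition wcong :: "nat \<Rightarrow> 'a::comm_ring_1 \<Rightarrow> 'a poly \<Rightarrow> 'a poly \<Rightarrow> bool" where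
  "wcong n g f f' \<longleftrightarrow> f - f' \<in> wideal n g"

lemma wcong_refl [simp]: "wcong n g f f"
  by (simp add: wcong_def)

lemma wcong_sym: "wcong n g f f' \<Longrightarrow> wcong n g f' f"
  using wideal_minus unfolding wcong_def by fastforce

lemma wcong_trans [trans]: "wcong n g f f' \<Longrightarrow> wcong n g f' f'' \<Longrightarrow> wcong n g f f''"
  unfolding wcong_def using wideal_add[of "f - f'" n g "f' - f''"] by simp

lemma wcong_add: "wcong n g f f' \<Longrightarrow> wcong n g h h' \<Longrightarrow> wcong n g (f + h) (f' + h')"
  unfolding wcong_def using wideal_add[of "f - f'" n g "h - h'"] by (simp add: algebra_simps)

lemma wcong_diff: "wcong n g f f' \<Longrightarrow> wcong n g h h' \<Longrightarrow> wcong n g (f - h) (f' - h')"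
  unfolding wcong_def using wideal_diff[of "f - f'" n g "h - h'"] by (simp add: algebra_simps)

lemma wcong_mult:
  assumes "n > 0" "wcong n g f f'" "wcong n g h h'"
  shows "wcong n g (f * h) (f' * h')"
proof -
  have "(f - f') * h + f' * (h - h') \<in> wideal n g"
    using assms unfolding wcong_def by (intro wideal_add wideal_mult_left wideal_mult_right)
  then show ?thesis unfolding wcong_def by (simp add: algebra_simps)
qed

lemma wcong_power: "n > 0 \<Longrightarrow> wcong n g f f' \<Longrightarrow> wcong n g (f ^ k) (f' ^ k)"
  by (induction k) (auto intro: wcong_mult)

lemma wcong_0_iff: "wcong n g f 0 \<longleftrightarrow> f \<in> wideal n g"
  by (simp add: wcong_def)

lemma wideal_wcong: "wcong n g f f' \<Longrightarrow> f' \<in> wideal n g \<Longrightarrow> f \<in> wideal n g"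
  unfolding wcong_0_iff[symmetric] by (rule wcong_trans)

lemma wcong_sum:
  "(\<And>i. i \<in> A \<Longrightarrow> wcong n g (f i) (f' i)) \<Longrightarrow> wcong n g (\<Sum>i\<in>A. f i) (\<Sum>i\<in>A. f' i)"
  by (induction A rule: infinite_finite_induct) (auto intro: wcong_add)

lemma wcong_dvd_mono: "wcong n g f f' \<Longrightarrow> g' dvd g \<Longrightarrow> wcong n g' f f'"
  unfolding wcong_def by (rule wideal_dvd_mono)

lemma wcong_monom:
  assumes "int n dvd int m - int m'"
  shows "wcong n g (monom a m) (monom a m')"
proof -
  have "int n dvd k - int m' \<longleftrightarrow> int n dvd k - int m" for k
    using dvd_add_right_iff[OF assms, of "k - int m"] by simp
  then show ?thesis by (simp add: wcong_def wideal_def wrap_diff wrap_monom)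
qed

lemma wcong_pcompose:
  "n > 0 \<Longrightarrow> wcong n g h h' \<Longrightarrow> wcong n g (pcompose f h) (pcompose f h')"
  by (induction f) (auto simp: pcompose_pCons intro!: wcong_add wcong_mult)

text \<open>For \<open>n > 0\<close> the power \<open>x^(n-1)\<close> represents the inverse of
  \<open>x\<close> in the quotient. As a substitution in \<open>R[x]\<close> this is an exact ring
  homomorphism, but it is an involution only modulo \<open>x^n - 1\<close>.\<close>

definition wstar :: "nat \<Rightarrow> 'a::comm_ring_1 poly \<Rightarrow> 'a poly" where
  "wstar n f = pcompose f (monom 1 (n - 1))"

lemma wstar_diff: "wstar n (f - g) = wstar n f - wstar n g"
  and wstar_mult: "wstar n (f * g) = wstar n f * wstar n g"
  and wstar_1 [simp]: "wstar n 1 = 1"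
  and wstar_const: "wstar n [:a:] = [:a:]"
  and wstar_smult: "wstar n (smult a f) = smult a (wstar n f)"
  by (simp_all add: wstar_def pcompose_diff pcompose_mult pcompose_1 pcompose_smult)

lemma wstar_power: "wstar n (f ^ k) = wstar n f ^ k"
  by (induction k) (simp_all add: wstar_mult)

lemma wrap_monom_mult: "wrap n (monom a m * f) k = a * wrap n f (k - int m)"
  by (induction m arbitrary: k) (simp_all add: monom_0 monom_Suc wrap_pCons wrap_smult algebra_simps)

lemma wrap_wstar:
  assumes "n > 0"
  shows "wrap n (wstar n f) k = wrap n f (- k)"
proof (induction f arbitrary: k)
  case 0
  then show ?case by (simp add: wstar_def)
next
  case (pCons a f)
  have "wrap n (wstar n (pCons a f)) k
      = (if int n dvd k then a else 0) + wrap n f (int (n - 1) - k)"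
    using assms pCons.IH by (simp add: wstar_def pcompose_pCons wrap_add wrap_monom_mult wrap_pCons)
  \<comment> \<open>\<open>n - 1\<close> and \<open>-1\<close> agree modulo
    \<open>n\<close>.\<close>
  also have "wrap n f (int (n - 1) - k) = wrap n f (- k - 1)"
    using assms by (intro wrap_periodic) (simp add: of_nat_diff)
  finally show ?case by (simp add: wrap_pCons)
qed

lemma wideal_wstar: "n > 0 \<Longrightarrow> f \<in> wideal n g \<Longrightarrow> wstar n f \<in> wideal n g"
  by (simp add: wideal_def wrap_wstar)

lemma wcong_wstar: "n > 0 \<Longrightarrow> wcong n g f f' \<Longrightarrow> wcong n g (wstar n f) (wstar n f')"
  using wideal_wstar[of n "f - f'" g] by (simp add: wcong_def wstar_diff)

lemma wstar_wstar: "n > 0 \<Longrightarrow> wcong n g (wstar n (wstar n f)) f"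
  by (simp add: wcong_def wideal_def wrap_diff wrap_wstar)

section \<open>Words of length \<open>n\<close> as residues of polynomials\<close>

definition word_of :: "nat \<Rightarrow> 'a::comm_ring_1 poly \<Rightarrow> nat \<Rightarrow> 'a" where
  "word_of n f = (\<lambda>i. if i < n then wrap n f (int i) else 0)"

definition poly_of :: "nat \<Rightarrow> (nat \<Rightarrow> 'a::comm_ring_1) \<Rightarrow> 'a poly" where
  "poly_of n c = (\<Sum>i<n. monom (c i) i)"

lemma wrap_poly_of:
  assumes "i < n"
  shows "wrap n (poly_of n c) (int i) = c i"
proof -
  have "int n dvd int i - int j \<longleftrightarrow> j = i" if "j < n" for j
    using assms that by (simp add: mod_eq_dvd_iff[symmetric] flip: zmod_int) auto
  then have "wrap n (poly_of n c) (int i) = (\<Sum>j<n. if j = i then c j else 0)"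
    unfolding poly_of_def wrap_sum wrap_monom by (intro sum.cong) auto
  then show ?thesis using assms by simp
qed

lemma word_of_poly_of: "c \<in> words n \<Longrightarrow> word_of n (poly_of n c) = c"
  by (auto simp: word_of_def wrap_poly_of words_def fun_eq_iff)

lemma word_of_words: "word_of n f \<in> words n"
  by (simp add: word_of_def words_def)

lemma wideal_iff:
  assumes "n > 0"
  shows "f \<in> wideal n g \<longleftrightarrow> (\<forall>i<n. g dvd word_of n f i)"
proof
  assume *: "\<forall>i<n. g dvd word_of n f i"
  have "g dvd wrap n f k" for k
  proof -
    have "nat (k mod int n) < n" using assms by (simp add: nat_less_iff)
    then show ?thesis
      using * assms by (auto simp: word_of_def wrap_mod dest!: spec[of _ "nat (k mod int n)"])
  qed
  then show "f \<in> wideal n g" by (simp add: wideal_def)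
qed (simp add: wideal_def word_of_def)

lemma word_of_eq_iff:
  assumes "n > 0"
  shows "word_of n f = word_of n f' \<longleftrightarrow> wcong n 0 f f'"
  unfolding wcong_def wideal_iff[OF assms]
  by (auto simp: word_of_def fun_eq_iff wrap_diff)

lemma word_of_add: "word_of n (f + g) = (\<lambda>i. word_of n f i + word_of n g i)"
  and word_of_smult: "word_of n (smult a f) = (\<lambda>i. a * word_of n f i)"
  and word_of_0: "word_of n 0 = (\<lambda>_. 0)"
  by (auto simp: word_of_def wrap_add wrap_smult)

lemma word_of_shift:
  assumes "n > 0"
  shows "word_of n (monom 1 1 * f) = cshift n (word_of n f)"
proof
  fix i
  have "wrap n f (int i - 1) = wrap n f (int ((i + n - 1) mod n))"
    using assms wrap_periodic[of n "int (i + n - 1)" "int i - 1" f]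
    by (simp add: wrap_mod zmod_int of_nat_diff)
  then show "word_of n (monom 1 1 * f) i = cshift n (word_of n f) i"
    using assms by (simp add: word_of_def cshift_def wrap_monom_mult)
qed

lemma inner_word_of:
  assumes "n > 0"
  shows "(\<Sum>i<n. word_of n f i * word_of n g i) = wrap n (f * wstar n g) 0"
  using assms by (simp add: wrap_mult wrap_wstar word_of_def)

text \<open>Pairing \<open>f\<close> with \<open>x^m\<close> reads off its coefficient at
  \<open>m\<close>. This turns orthogonality to all shifts of a word into the vanishing of a
  product.\<close>

lemma wideal_0_iff_shifts:
  assumes "n > 0"
  shows "f \<in> wideal n 0 \<longleftrightarrow> (\<forall>m. wrap n (f * wstar n (monom 1 m)) 0 = 0)"
proof -
  have *: "wrap n (f * wstar n (monom 1 m)) 0 = wrap n f (int m)" for m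
  proof -
    \<comment> \<open>The star keeps the constant coefficient and moves itself from the monomial
      onto \<open>f\<close>.\<close>
    have "wrap n (f * wstar n (monom 1 m)) 0 = wrap n (wstar n (f * wstar n (monom 1 m))) 0"
      using assms by (simp add: wrap_wstar)
    also have "\<dots> = wrap n (monom 1 m * wstar n f) 0"
    proof -
      have "wcong n 0 (wstar n (f * wstar n (monom 1 m))) (monom 1 m * wstar n f)"
        unfolding wstar_mult mult.commute[of "monom 1 m"]
        by (intro wcong_mult wcong_refl wstar_wstar assms)
      then show ?thesis by (simp add: wcong_def wideal_def wrap_diff)
    qed
    finally show ?thesis using assms by (simp add: wrap_monom_mult wrap_wstar)
  qed
  have "wrap n f (int m) = word_of n f (m mod n)" for m
    using assms wrap_mod[of n f "int m"] by (simp add: word_of_def zmod_int)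
  then show ?thesis
    unfolding * wideal_iff[OF assms] using assms
    by (metis dvd_0_left_iff mod_less mod_less_divisor)
qed

lemma wideal_divide:
  assumes "n > 0" "f \<in> wideal n g"
  obtains u where "wcong n 0 f (smult g u)"
proof -
  have "\<forall>i. \<exists>v. i < n \<longrightarrow> word_of n f i = g * v"
    using assms by (auto simp: wideal_iff dvd_def)
  then obtain v where v: "\<And>i. i < n \<Longrightarrow> word_of n f i = g * v i" by metis
  have "word_of n f = word_of n (smult g (poly_of n v))"
    using v unfolding word_of_smult by (auto simp: word_of_def wrap_poly_of fun_eq_iff)
  then show ?thesis using that assms(1) by (simp add: word_of_eq_iff)
qed

section \<open>Arithmetic modulo the uniformizer\<close>

lemma dvd_diff_trans:
  fixes g :: "'a::comm_ring_1"
  shows "g dvd x - y \<Longrightarrow> g dvd y - z \<Longrightarrow> g dvd x - z"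
  using dvd_add[of g "x - y" "y - z"] by simp

lemma dvd_prod_diff:
  fixes f h :: "'b \<Rightarrow> 'a::comm_ring_1"
  assumes "\<And>i. i \<in> A \<Longrightarrow> g dvd f i - h i"
  shows "g dvd (\<Prod>i\<in>A. f i) - (\<Prod>i\<in>A. h i)"
  using assms
proof (induction A rule: infinite_finite_induct)
  case (insert x A)
  have "f x * prod f A - h x * prod h A = (f x - h x) * prod f A + h x * (prod f A - prod h A)"
    by (simp add: algebra_simps)
  moreover have "g dvd (f x - h x) * prod f A + h x * (prod f A - prod h A)"
    using insert by (intro dvd_add dvd_mult dvd_mult2) auto
  ultimately show ?case using insert.hyps by simp
qed simp_all

lemma dvd_power_diff:
  fixes x y :: "'a::comm_ring_1"
  assumes "g dvd x - y"
  shows "g dvd x ^ k - y ^ k"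
  using dvd_prod_diff[of "{..<k}" g "\<lambda>_. x" "\<lambda>_. y"] assms by simp

text \<open>The inner binomial coefficients are multiples of \<open>p\<close>. Divisibility replaces
  equality because the characteristic need not be \<open>p\<close>.\<close>

lemma freshman_dream_dvd:
  fixes a b :: "'a::comm_ring_1"
  assumes "prime p"
  shows "of_nat p dvd (a + b) ^ p - (a ^ p + b ^ p)"
proof -
  have p: "p > 0" using assms prime_gt_0_nat by blast
  have "(a + b) ^ p = (\<Sum>k\<le>p. of_nat (p choose k) * a ^ k * b ^ (p - k))"
    by (rule binomial_ring)
  also have "{..p} = insert 0 (insert p {1..<p})" using p by auto
  finally have "(a + b) ^ p - (a ^ p + b ^ p)
      = (\<Sum>k\<in>{1..<p}. of_nat (p choose k) * a ^ k * b ^ (p - k))"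
    using p by simp
  also have "of_nat p dvd \<dots>"
  proof (rule dvd_sum)
    fix k assume "k \<in> {1..<p}"
    then have "p dvd (p choose k)" using assms by (intro dvd_choose_prime) auto
    then have "(of_nat p :: 'a) dvd of_nat (p choose k)" by (metis dvd_def of_nat_mult)
    then show "(of_nat p :: 'a) dvd of_nat (p choose k) * a ^ k * b ^ (p - k)"
      by (intro dvd_mult2)
  qed
  finally show ?thesis .
qed

lemma freshman_dream_power_dvd:
  fixes a b :: "'a::comm_ring_1"
  assumes "prime p"
  shows "of_nat p dvd (a + b) ^ (p ^ k) - (a ^ (p ^ k) + b ^ (p ^ k))"
proof (induction k)
  case (Suc k)
  let ?q = "p ^ k"
  have "of_nat p dvd ((a + b) ^ ?q) ^ p - (a ^ ?q + b ^ ?q) ^ p"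
    by (rule dvd_power_diff[OF Suc])
  moreover have "of_nat p dvd (a ^ ?q + b ^ ?q) ^ p - ((a ^ ?q) ^ p + (b ^ ?q) ^ p)"
    by (rule freshman_dream_dvd[OF assms])
  ultimately have "of_nat p dvd ((a + b) ^ ?q) ^ p - ((a ^ ?q) ^ p + (b ^ ?q) ^ p)"
    by (rule dvd_diff_trans)
  then show ?case by (simp add: power_mult[symmetric] mult.commute)
qed simp

lemma pcompose_monom_1: "pcompose (monom 1 k) y = (y::'a::comm_ring_1 poly) ^ k"
  by (induction k) (simp_all add: monom_0 monom_Suc pcompose_pCons)

lemma degree_less_of_coeff_0:
  assumes "degree f \<le> k" "coeff f k = 0" "k > 0"
  shows "degree f < k"
proof (rule ccontr)
  assume "\<not> degree f < k"
  then have "degree f = k" using assms(1) by simp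
  then have "f = 0" using assms(2) leading_coeff_0_iff by blast
  then show False using assms(3) \<open>degree f = k\<close> by simp
qed

text \<open>Degree bound and top coefficient together say that the product is monic; this form suits
  rings with zero divisors, where degrees need not add.\<close>

lemma prod_linear_monic:
  fixes S :: "'a::comm_ring_1 set"
  assumes "finite S"
  shows "degree (\<Prod>c\<in>S. [:- c, 1:]) \<le> card S \<and> coeff (\<Prod>c\<in>S. [:- c, 1:]) (card S) = 1"
  using assms
proof (induction S)
  case (insert c S)
  let ?P = "\<Prod>c\<in>S. [:- c, 1:]"
  have prod: "(\<Prod>c\<in>insert c S. [:- c, 1:]) = [:- c, 1:] * ?P"
    using insert.hyps by simp
  have card: "card (insert c S) = Suc (card S)" using insert.hyps by simp
  have "degree ([:- c, 1:] * ?P) \<le> degree [:- c, 1:] + degree ?P" by (rule degree_mult_le)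
  also have "\<dots> \<le> Suc (card S)" using insert.IH by simp
  finally have "degree ([:- c, 1:] * ?P) \<le> Suc (card S)" .
  moreover have "coeff ?P (Suc (card S)) = 0" using insert.IH by (intro coeff_eq_0) simp
  then have "coeff ([:- c, 1:] * ?P) (Suc (card S)) = 1" using insert.IH by simp
  ultimately show ?case unfolding prod card by simp
qed simp

section \<open>Divisibility by \<gamma>: units, annihilators and roots\<close>

locale uniformizer =
  fixes \<gamma> :: "'a::comm_ring_1" and e :: nat
  assumes nonunit_iff: "\<not> x dvd 1 \<longleftrightarrow> \<gamma> dvd x"
    and power_e: "\<gamma> ^ e = 0"
    and power_e_minus_1: "\<gamma> ^ (e - 1) \<noteq> 0"
begin

lemma not_dvd_1: "\<not> \<gamma> dvd 1"
  using nonunit_iff[of \<gamma>] by simp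

lemma e_pos: "e > 0"
  \<comment> \<open>For \<open>e = 0\<close> the subtraction truncates, and the two axioms would say
    \<open>1 = 0\<close> and \<open>1 \<noteq> 0\<close>.\<close>
  using power_e power_e_minus_1 by (cases e) auto

lemma unitE:
  assumes "\<not> \<gamma> dvd b"
  obtains c where "b * c = 1"
  using nonunit_iff[of b] assms by (auto simp: dvd_def)

lemma unit_cancel:
  assumes "a * b = 0" "\<not> \<gamma> dvd b"
  shows "a = 0"
proof -
  obtain c where "b * c = 1" using assms(2) by (rule unitE)
  then have "a = (a * b) * c" by (simp add: mult.assoc)
  then show ?thesis using assms(1) by simp
qed

lemma dvd_mult_cancel_unit:
  assumes "\<gamma> dvd a * b" "\<not> \<gamma> dvd b"
  shows "\<gamma> dvd a"
proof -
  obtain c where "b * c = 1" using assms(2) by (rule unitE)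
  then have "a = (a * b) * c" by (simp add: mult.assoc)
  then show ?thesis using assms(1) dvd_mult2[of \<gamma> "a * b" c] by simp
qed

lemma not_dvd_prod: "(\<And>i. i \<in> A \<Longrightarrow> \<not> \<gamma> dvd f i) \<Longrightarrow> \<not> \<gamma> dvd (\<Prod>i\<in>A. f i)"
proof (induction A rule: infinite_finite_induct)
  case (insert x A)
  then show ?case using dvd_mult_cancel_unit[of "f x" "prod f A"] by auto
qed (simp_all add: not_dvd_1)

text \<open>While \<open>i + j < e\<close>, the power \<open>\<gamma>^(i+j)\<close> is nonzero, so
  the cofactor \<open>s\<close> in \<open>t = \<gamma>^j * s\<close> cannot be a unit and supplies
  one more factor \<gamma>.\<close>

lemma annihilator:
  assumes "\<gamma> ^ i * t = 0" "i + j \<le> e"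
  shows "\<gamma> ^ j dvd t"
  using assms(2)
proof (induction j)
  case (Suc j)
  then obtain s where s: "t = \<gamma> ^ j * s" by auto
  have "\<gamma> ^ (i + j) * s = 0" using assms(1) s by (simp add: power_add mult.assoc)
  moreover have "\<gamma> ^ (i + j) \<noteq> 0"
  proof
    assume "\<gamma> ^ (i + j) = 0"
    moreover have "\<gamma> ^ (i + j) dvd \<gamma> ^ (e - 1)"
      using Suc.prems by (intro le_imp_power_dvd) simp
    ultimately have "\<gamma> ^ (e - 1) = 0" by simp
    then show False using power_e_minus_1 by simp
  qed
  ultimately have "\<gamma> dvd s" using unit_cancel[of "\<gamma> ^ (i + j)" s] by auto
  then show ?case unfolding s by (simp add: mult.commute mult_dvd_mono)
qed simp

text \<open>Over a field, a polynomial with more roots than its degree is zero. This is read modulo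
  \<gamma>, dividing off one root at a time.\<close>

lemma dvd_coeff_of_many_roots:
  assumes "finite S" "\<And>c d. c \<in> S \<Longrightarrow> d \<in> S \<Longrightarrow> \<gamma> dvd c - d \<Longrightarrow> c = d"
    and "\<And>c. c \<in> S \<Longrightarrow> \<gamma> dvd poly D c" "degree D < card S"
  shows "[:\<gamma>:] dvd D"
  using assms
proof (induction S arbitrary: D)
  case (insert c S)
  let ?E = "synthetic_div D c"
  have D: "D = [:- c, 1:] * ?E + [:poly D c:]"
    by (rule synthetic_div_correct'[symmetric])
  have "[:\<gamma>:] dvd ?E"
  proof (cases "?E = 0")
    case False
    then have "degree D \<noteq> 0" by (simp add: synthetic_div_eq_0_iff)
    then have deg: "degree ?E < card S"
      using insert by (simp add: degree_synthetic_div)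
    have "\<gamma> dvd poly ?E x" if "x \<in> S" for x
    proof -
      \<comment> \<open>Both values of \<open>D\<close> are multiples of \<gamma>, and
        \<open>x - c\<close> is a unit since elements of the root set are distinct modulo
        \<gamma>.\<close>
      have "poly D x = (x - c) * poly ?E x + poly D c"
        by (subst D) (simp add: algebra_simps)
      then have "\<gamma> dvd poly ?E x * (x - c)"
        using dvd_diff[OF insert.prems(2)[of x] insert.prems(2)[of c]] that by (simp add: mult.commute)
      moreover have "\<not> \<gamma> dvd x - c" using insert.prems(1)[of x c] insert.hyps that by auto
      ultimately show ?thesis by (rule dvd_mult_cancel_unit)
    qed
    then show ?thesis using insert.prems(1) deg by (intro insert.IH) auto
  qed simp
  moreover have "[:\<gamma>:] dvd [:poly D c:]"
  proof -
    obtain b where "poly D c = \<gamma> * b" using insert.prems(2)[of c] by (auto elim: dvdE)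
    then have "[:poly D c:] = [:\<gamma>:] * [:b:]" by simp
    then show ?thesis by (rule dvdI)
  qed
  ultimately show ?case by (subst D) (intro dvd_add dvd_mult)
qed simp

end

section \<open>Fermat and Frobenius modulo \<gamma>, through a transversal \<open>S\<close> of the
  residue field\<close>

locale residue_reps = uniformizer \<gamma> e for \<gamma> :: "'a::comm_ring_1" and e +
  fixes p r :: nat and S :: "'a set"
  assumes prime_p: "prime p"
    and finite_S: "finite S"
    and card_S: "card S = p ^ r"
    and S_inj: "c \<in> S \<Longrightarrow> d \<in> S \<Longrightarrow> \<gamma> dvd c - d \<Longrightarrow> c = d"
    and S_ex: "\<exists>c\<in>S. \<gamma> dvd x - c"
begin

definition rep :: "'a \<Rightarrow> 'a" where
  "rep x = (SOME c. c \<in> S \<and> \<gamma> dvd x - c)"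

lemma rep_in: "rep x \<in> S" and rep_dvd: "\<gamma> dvd x - rep x"
  using someI_ex[of "\<lambda>c. c \<in> S \<and> \<gamma> dvd x - c"] S_ex[of x] unfolding rep_def by blast+

lemma rep_eq_dvd: "rep x = rep y \<Longrightarrow> \<gamma> dvd x - y"
  using dvd_diff[OF rep_dvd[of x] rep_dvd[of y]] by simp

text \<open>Translation by \<open>1\<close> permutes the residues; comparing sums over
  \<open>S\<close> shows that \<open>p^r\<close> vanishes modulo \<gamma>, and a product of units is
  a unit.\<close>

lemma gamma_dvd_p: "\<gamma> dvd of_nat p"
proof -
  let ?f = "\<lambda>c. rep (c + 1)"
  have inj: "inj_on ?f S"
  proof (rule inj_onI)
    fix c d assume "c \<in> S" "d \<in> S" "rep (c + 1) = rep (d + 1)"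
    then show "c = d" using S_inj rep_eq_dvd[of "c + 1" "d + 1"] by simp
  qed
  then have "?f ` S = S" using finite_S rep_in by (intro endo_inj_surj) auto
  then have "(\<Sum>c\<in>S. ?f c) = \<Sum>S" using inj sum.reindex[OF inj, of id] by simp
  moreover have "\<gamma> dvd (\<Sum>c\<in>S. (c + 1) - ?f c)" by (rule dvd_sum) (rule rep_dvd)
  ultimately have "\<gamma> dvd of_nat (card S)" by (simp add: sum_subtractf sum.distrib)
  then have "\<gamma> dvd of_nat p ^ r" by (simp add: card_S)
  then show ?thesis using not_dvd_prod[of "{..<r}" "\<lambda>_. of_nat p"] by auto
qed

text \<open>Multiplication by a unit permutes the nonzero residues; compare the products over
  them.\<close>

lemma fermat: "\<gamma> dvd x ^ (p ^ r) - x"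
proof (cases "\<gamma> dvd x")
  case True
  moreover have "p ^ r > 0" using prime_p prime_gt_0_nat by simp
  ultimately show ?thesis by (intro dvd_diff) (auto intro: dvd_trans[OF _ dvd_power])
next
  case False
  \<comment> \<open>Representatives of the nonzero residues; \<open>rep 0\<close> need not be
    \<open>0\<close> itself.\<close>
  define T where "T = S - {rep 0}"
  let ?f = "\<lambda>c. rep (x * c)"
  have T: "finite T" "card T = p ^ r - 1"
    using finite_S rep_in card_S by (auto simp: T_def)
  have T_iff: "c \<in> T \<longleftrightarrow> c \<in> S \<and> \<not> \<gamma> dvd c" for c
    unfolding T_def using S_inj[of c "rep 0"] rep_in[of 0] rep_dvd[of 0]
    by (auto simp: dvd_diff)
  have inj: "inj_on ?f T"
  proof (rule inj_onI)
    fix c d assume cd: "c \<in> T" "d \<in> T" "rep (x * c) = rep (x * d)"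
    then have "\<gamma> dvd (c - d) * x" using rep_eq_dvd[of "x * c" "x * d"] by (simp add: algebra_simps)
    then have "\<gamma> dvd c - d" using False by (rule dvd_mult_cancel_unit)
    then show "c = d" using S_inj cd T_iff by simp
  qed
  have "?f c \<in> T" if "c \<in> T" for c
  proof -
    have "\<not> \<gamma> dvd x * c" using that False T_iff dvd_mult_cancel_unit[of x c] by auto
    then have "\<not> \<gamma> dvd ?f c" using dvd_add[OF rep_dvd[of "x * c"], of "?f c"] by auto
    then show ?thesis by (simp add: T_iff rep_in)
  qed
  then have "?f ` T = T" using inj T by (intro endo_inj_surj) auto
  then have "(\<Prod>c\<in>T. ?f c) = \<Prod>T" using inj prod.reindex[OF inj, of id] by simp
  moreover have "\<gamma> dvd (\<Prod>c\<in>T. x * c) - (\<Prod>c\<in>T. ?f c)"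
    by (rule dvd_prod_diff) (rule rep_dvd)
  ultimately have "\<gamma> dvd (x ^ (p ^ r - 1) - 1) * \<Prod>T"
    by (simp add: prod.distrib T algebra_simps)
  moreover have "\<not> \<gamma> dvd \<Prod>T" using T_iff by (intro not_dvd_prod) simp
  ultimately have "\<gamma> dvd (x ^ (p ^ r - 1) - 1)" by (rule dvd_mult_cancel_unit)
  then have "\<gamma> dvd (x ^ (p ^ r - 1) - 1) * x" by simp
  moreover have "x ^ (p ^ r - 1) * x = x ^ (p ^ r)"
    using prime_p prime_gt_0_nat by (metis power_minus_mult zero_less_power)
  ultimately show ?thesis by (simp add: algebra_simps)
qed

lemma fermat_power: "\<gamma> dvd x ^ ((p ^ r) ^ i) - x"
proof (induction i)
  case (Suc i)
  have "\<gamma> dvd (x ^ ((p ^ r) ^ i)) ^ (p ^ r) - x ^ (p ^ r)"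
    by (rule dvd_power_diff[OF Suc])
  from dvd_diff_trans[OF this fermat] show ?case
    by (simp add: power_mult[symmetric] mult.commute)
qed simp

lemma card_gt_1: "p ^ r > 1"
proof (rule ccontr)
  assume "\<not> p ^ r > 1"
  then have "card S \<le> 1" by (simp add: card_S)
  then have "rep 1 = rep 0" using rep_in finite_S by (metis card_le_Suc0_iff_eq One_nat_def)
  then show False using rep_eq_dvd[of 1 0] not_dvd_1 by simp
qed

text \<open>The factorization of \<open>x^q - x\<close> over a field with \<open>q\<close> elements.
  The leading terms cancel, so the difference has degree below \<open>p^r\<close>, yet all of
  \<open>S\<close> are roots modulo \<gamma>.\<close>

lemma dvd_field_polynomial:
  "[:\<gamma>:] dvd monom 1 (p ^ r) - monom 1 1 - (\<Prod>c\<in>S. [:- c, 1:])" (is "_ dvd ?D")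
proof (rule dvd_coeff_of_many_roots[OF finite_S S_inj])
  fix c assume "c \<in> S"
  then have "poly (\<Prod>c\<in>S. [:- c, 1:]) c = 0"
    unfolding poly_prod using finite_S by (intro prod_zero) auto
  then show "\<gamma> dvd poly ?D c" by (simp add: poly_monom fermat)
next
  let ?P = "\<Prod>c\<in>S. [:- c, 1:]"
  have P: "degree ?P \<le> p ^ r" "coeff ?P (p ^ r) = 1"
    using prod_linear_monic[OF finite_S] by (auto simp: card_S)
  have "degree ?D \<le> p ^ r"
    using P(1) card_gt_1 by (intro degree_diff_le) (auto intro: order_trans[OF degree_monom_le])
  moreover have "coeff ?D (p ^ r) = 0" using P(2) card_gt_1 by simp
  ultimately have "degree ?D < p ^ r"
    by (rule degree_less_of_coeff_0) (use card_gt_1 in linarith)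
  then show "degree ?D < card S" by (simp add: card_S)
qed

text \<open>Substitution of \<open>y\<close> into the factorization of \<open>x^q - x\<close>. The
  product vanishes even if no single factor does.\<close>

lemma wcong_prod_S:
  assumes "n > 0" "wcong n \<gamma> (y ^ (p ^ r)) y"
  shows "(\<Prod>c\<in>S. y - [:c:]) \<in> wideal n \<gamma>"
proof -
  obtain D where D: "monom 1 (p ^ r) - monom 1 1 - (\<Prod>c\<in>S. [:- c, 1:]) = smult \<gamma> D"
    using dvd_field_polynomial by (elim dvdE) simp
  have "pcompose [:- c, 1:] y = y - [:c:]" for c
    by (simp add: pcompose_pCons)
  then have "y ^ (p ^ r) - y - (\<Prod>c\<in>S. y - [:c:]) = smult \<gamma> (pcompose D y)"
    using arg_cong[OF D, of "\<lambda>f. pcompose f y"]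
    by (simp add: pcompose_diff pcompose_prod pcompose_monom_1 pcompose_smult)
  then have "(\<Prod>c\<in>S. y - [:c:]) = (y ^ (p ^ r) - y) - smult \<gamma> (pcompose D y)"
    by (simp add: algebra_simps)
  then show ?thesis
    using assms(2) by (simp add: wcong_def wideal_diff wideal_smult)
qed

lemma wideal_of_nat_p_dvd: "of_nat p dvd f \<Longrightarrow> f \<in> wideal n \<gamma>"
  using gamma_dvd_p by (auto simp: of_nat_poly wideal_def wrap_smult elim!: dvdE[of "of_nat p"])

lemma wcong_freshman:
  "wcong n \<gamma> ((f + g) ^ ((p ^ r) ^ i)) (f ^ ((p ^ r) ^ i) + g ^ ((p ^ r) ^ i))"
  unfolding wcong_def
  using wideal_of_nat_p_dvd[OF freshman_dream_power_dvd[OF prime_p, of f g "r * i"]] by (simp add: power_mult)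

lemma wcong_const: "\<gamma> dvd a - b \<Longrightarrow> wcong n \<gamma> [:a:] [:b:]"
  by (auto simp: wcong_def wideal_def wrap_pCons)

text \<open>The freshman's dream splits off the constant term, which Fermat fixes; induction treats
  the rest.\<close>

lemma frobenius:
  assumes "n > 0"
  shows "wcong n \<gamma> (f ^ ((p ^ r) ^ i)) (pcompose f (monom 1 ((p ^ r) ^ i)))"
proof (induction f)
  case 0
  have "(0::'a poly) ^ ((p ^ r) ^ i) = 0"
    using prime_gt_0_nat[OF prime_p] by (intro zero_power) simp
  then show ?case by simp
next
  case (pCons a f)
  let ?Q = "(p ^ r) ^ i"
  have "pCons a f ^ ?Q = ([:a:] + monom 1 1 * f) ^ ?Q"
    by (simp add: monom_altdef)
  also have "wcong n \<gamma> \<dots> ([:a:] ^ ?Q + (monom 1 1 * f) ^ ?Q)"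
    by (rule wcong_freshman)
  also have "\<dots> = [:a ^ ?Q:] + monom 1 ?Q * f ^ ?Q"
    by (simp add: poly_const_pow power_mult_distrib monom_power)
  also have "wcong n \<gamma> \<dots> ([:a:] + monom 1 ?Q * pcompose f (monom 1 ?Q))"
    by (intro wcong_add wcong_mult wcong_const fermat_power pCons.IH assms wcong_refl)
  finally show ?case by (simp add: pcompose_pCons)
qed

end

lemma residue_field_reps:
  fixes \<gamma> :: "'a::comm_ring_1"
  assumes "card (residue_field \<gamma>) > 0"
  obtains S where "finite S" "card S = card (residue_field \<gamma>)"
    "\<And>c d. c \<in> S \<Longrightarrow> d \<in> S \<Longrightarrow> \<gamma> dvd c - d \<Longrightarrow> c = d"
    "\<And>x. \<exists>c\<in>S. \<gamma> dvd x - c"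
proof -
  define coset where "coset x = (\<lambda>y. x + y) ` pideal \<gamma>" for x
  have mem: "y \<in> coset x \<longleftrightarrow> \<gamma> dvd y - x" for x y
  proof -
    have "y \<in> coset x \<longleftrightarrow> (\<exists>a. y - x = \<gamma> * a)"
      by (auto simp: coset_def pideal_def image_iff algebra_simps eq_diff_eq) 
    then show ?thesis by (simp add: dvd_def)
  qed
  have eq: "coset x = coset y \<longleftrightarrow> \<gamma> dvd x - y" for x y
  proof
    assume "coset x = coset y"
    then show "\<gamma> dvd x - y" using mem[of x x] mem[of x y] by simp
  next
    assume *: "\<gamma> dvd x - y"
    have "\<gamma> dvd z - x \<longleftrightarrow> \<gamma> dvd z - y" for z
      using dvd_add_left_iff[OF *, of "z - x"] by simp
    then show "coset x = coset y" by (auto simp: mem)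
  qed
  have rf: "residue_field \<gamma> = range coset"
    by (auto simp: residue_field_def coset_def)
  define S where "S = inv coset ` range coset"
  \<comment> \<open>Positive \<open>card\<close> carries finiteness, since infinite sets have
    \<open>card\<close> zero.\<close>
  have fin: "finite (range coset)" using assms rf card_gt_0_iff by metis
  show ?thesis
  proof (rule that[of S])
    show "finite S" using fin by (simp add: S_def)
    show "card S = card (residue_field \<gamma>)"
      unfolding rf S_def by (intro card_image inj_on_inv_into) simp
    show "c = d" if "c \<in> S" "d \<in> S" "\<gamma> dvd c - d" for c d
      using that unfolding eq[symmetric] S_def by (auto simp: f_inv_into_f)
    show "\<exists>c\<in>S. \<gamma> dvd x - c" for x
      unfolding eq[symmetric] S_def by (auto simp: f_inv_into_f)
  qed
qed

section \<open>Self-dual cyclic codes\<close>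

lemma word_of_monom_mult_mem:
  assumes "n > 0" "cyclic_code n C" "word_of n b \<in> C"
  shows "word_of n (monom 1 m * b) \<in> C"
proof (induction m)
  case 0
  then show ?case using assms by (simp add: monom_0)
next
  case (Suc m)
  have "monom 1 (Suc m) * b = monom 1 1 * (monom 1 m * b)"
    by (simp add: mult_monom mult.assoc[symmetric])
  then show ?case using assms(2) Suc by (simp only: word_of_shift[OF assms(1)] cyclic_code_def)
qed

text \<open>Self-duality alone kills the constant coefficient of the product; cyclicity allows
  \<open>x^m * b\<close> in place of \<open>b\<close>, which kills every other coefficient.\<close>

lemma cyclic_self_dual_mult_wstar:
  assumes "n > 0" "cyclic_code n C" "self_dual n C" "word_of n a \<in> C" "word_of n b \<in> C"
  shows "a * wstar n b \<in> wideal n 0"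
proof -
  have "wrap n (a * wstar n b * wstar n (monom 1 m)) 0 = 0" for m
  proof -
    have "word_of n a \<in> dual_code n C" using assms by (simp add: self_dual_def)
    then have "(\<Sum>i<n. word_of n a i * word_of n (monom 1 m * b) i) = 0"
      using word_of_monom_mult_mem[OF assms(1,2,5), of m] by (auto simp: dual_code_def)
    then show ?thesis
      unfolding inner_word_of[OF assms(1)] wstar_mult by (simp add: mult_ac)
  qed
  then show ?thesis using wideal_0_iff_shifts[OF assms(1)] by blast
qed

lemma mem_trivial_sd_code:
  "c \<in> trivial_sd_code n g e \<longleftrightarrow> c \<in> words n \<and> (\<forall>i<n. g ^ (e div 2) dvd c i)"
proof
  assume "c \<in> trivial_sd_code n g e"
  then show "c \<in> words n \<and> (\<forall>i<n. g ^ (e div 2) dvd c i)"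
    by (auto simp: trivial_sd_code_def words_def)
next
  assume c: "c \<in> words n \<and> (\<forall>i<n. g ^ (e div 2) dvd c i)"
  then have "\<forall>i. \<exists>v. i < n \<longrightarrow> c i = g ^ (e div 2) * v" by (auto simp: dvd_def)
  then obtain v where v: "\<And>i. i < n \<Longrightarrow> c i = g ^ (e div 2) * v i" by metis
  define v' where "v' i = (if i < n then v i else 0)" for i
  have "v' \<in> words n" by (simp add: v'_def words_def)
  moreover have "c = (\<lambda>i. g ^ (e div 2) * v' i)"
    using c v by (auto simp: v'_def words_def fun_eq_iff not_less)
  ultimately show "c \<in> trivial_sd_code n g e" by (auto simp: trivial_sd_code_def)
qed

section \<open>Idempotents and the self-dual code built from them\<close>

context uniformizer
begin

lemma wideal_cancel:
  assumes "smult (\<gamma> ^ i) f \<in> wideal n 0" "i + j \<le> e"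
  shows "f \<in> wideal n (\<gamma> ^ j)"
  using assms(1) annihilator[OF _ assms(2)] by (simp add: wideal_def wrap_smult)

text \<open>A Newton step turns the error \<open>h\<close> into \<open>h^2 * (4h - 3)\<close>,
  gaining at least one factor \<gamma>; the error is zero once \<open>\<gamma>^e\<close> is
  reached.\<close>

lemma lift_idempotent:
  assumes "n > 0" "wcong n \<gamma> (f * f) f"
  obtains g where "wcong n \<gamma> g f" "wcong n 0 (g * g) g"
proof -
  have "\<exists>g. wcong n \<gamma> g f \<and> wcong n (\<gamma> ^ Suc k) (g * g) g" for k
  proof (induction k)
    case 0
    show ?case by (rule exI[of _ f]) (simp add: assms(2))
  next
    case (Suc k)
    then obtain g where g: "wcong n \<gamma> g f" "wcong n (\<gamma> ^ Suc k) (g * g) g" by blast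
    define h where "h = g * g - g"
    \<comment> \<open>one Newton step, \<open>g' = 3g\<^sup>2 - 2g\<^sup>3\<close>\<close>
    define g' where "g' = g + h * (1 - g - g)"
    have h: "h \<in> wideal n (\<gamma> ^ Suc k)" using g(2) by (simp add: h_def wcong_def)
    have h1: "h \<in> wideal n \<gamma>" by (rule wideal_dvd_mono[OF h]) simp
    have "wcong n \<gamma> g' (g + 0)"
      unfolding g'_def using h1 assms(1)
      by (intro wcong_add wcong_refl) (auto simp: wcong_0_iff intro: wideal_mult_right)
    then have "wcong n \<gamma> g' f" using g(1) wcong_trans by simp
    moreover have "g' * g' - g' = h * h * (h + h + h + h - (1 + 1 + 1))"
      unfolding g'_def h_def by (simp only: algebra_simps mult_1_left mult_1_right)
    moreover have "h * h * (h + h + h + h - (1 + 1 + 1)) \<in> wideal n (\<gamma> * \<gamma> ^ Suc k)"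
      using assms(1) h h1 by (intro wideal_mult_right wideal_mult)
    ultimately show ?case by (auto simp: wcong_def)
  qed
  from this[of "e - 1"] show ?thesis using that e_pos power_e by auto
qed

text \<open>An idempotent equals its own \<open>e\<close>-th power, which here is a multiple of
  \<open>\<gamma>^e = 0\<close>.\<close>

lemma idempotent_wideal:
  assumes "n > 0" "wcong n 0 (f * f) f" "f \<in> wideal n \<gamma>"
  shows "f \<in> wideal n 0"
proof -
  have "wcong n 0 (f ^ Suc k) f" for k
  proof (induction k)
    case (Suc k)
    have "wcong n 0 (f * f ^ Suc k) (f * f)" by (intro wcong_mult assms Suc wcong_refl)
    then show ?case using wcong_trans assms(2) by simp
  qed simp
  from this[of "e - 1"] have "wcong n 0 (f ^ e) f" using e_pos by simp
  moreover have "f ^ e \<in> wideal n 0" using wideal_power[OF assms(1,3), of e] by (simp add: power_e)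
  ultimately show ?thesis using wcong_sym wideal_wcong by blast
qed

lemma self_dual_code_of_idempotent:
  assumes "n > 0" "even e" "wcong n 0 (\<epsilon> * \<epsilon>) \<epsilon>" "\<epsilon> * wstar n \<epsilon> \<in> wideal n 0" "\<epsilon> \<notin> wideal n \<gamma>"
  shows "\<exists>C. cyclic_code n C \<and> self_dual n C \<and> C \<noteq> trivial_sd_code n \<gamma> e"
proof -
  define h where "h = e div 2"
  have e: "e = h + h" using assms(2) by (auto simp: h_def)
  have h_pos: "h > 0" using e e_pos by simp
  define \<eta> where "\<eta> = wstar n \<epsilon>"
  \<comment> \<open>In the quotient, \<epsilon>, \<eta> and \<delta> are orthogonal idempotents with
    sum \<open>1\<close>; the star swaps the first two and fixes \<delta>.\<close>
  define \<delta> where "\<delta> = 1 - \<epsilon> - \<eta>"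
  note n = assms(1)
  have eps: "\<epsilon> * \<epsilon> - \<epsilon> \<in> wideal n 0" using assms(3) by (simp add: wcong_def)
  have eta: "\<eta> * \<eta> - \<eta> \<in> wideal n 0"
    using wideal_wstar[OF n eps] by (simp add: wstar_diff wstar_mult \<eta>_def)
  have eps_eta: "\<epsilon> * \<eta> \<in> wideal n 0" using assms(4) by (simp add: \<eta>_def)
  have star_eta: "wstar n \<eta> - \<epsilon> \<in> wideal n 0"
    using wstar_wstar[OF n, of 0 \<epsilon>] by (simp add: \<eta>_def wcong_def)
  have "wstar n \<delta> - \<delta> = - (wstar n \<eta> - \<epsilon>)"
    by (simp add: \<delta>_def wstar_diff flip: \<eta>_def)
  then have star_delta: "wstar n \<delta> - \<delta> \<in> wideal n 0" using wideal_minus[OF star_eta] by simp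
  have "\<delta> * \<delta> - \<delta> = (\<epsilon> * \<epsilon> - \<epsilon>) + (\<eta> * \<eta> - \<eta>) + (\<epsilon> * \<eta> + \<epsilon> * \<eta>)"
    by (simp add: \<delta>_def algebra_simps)
  then have delta: "\<delta> * \<delta> - \<delta> \<in> wideal n 0"
    using eps eta eps_eta n by (auto intro: wideal_add wideal_mult_left)
  have eps_delta: "\<epsilon> * \<delta> \<in> wideal n 0"
  proof -
    have "\<epsilon> * \<delta> = - (\<epsilon> * \<epsilon> - \<epsilon>) - \<epsilon> * \<eta>" by (simp add: \<delta>_def algebra_simps)
    then show ?thesis using wideal_diff[OF wideal_minus[OF eps] eps_eta] by simp
  qed
  have eta_delta: "\<eta> * \<delta> \<in> wideal n 0"
  proof -
    have "\<eta> * \<delta> = - (\<eta> * \<eta> - \<eta>) - \<epsilon> * \<eta>" by (simp add: \<delta>_def algebra_simps)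
    then show ?thesis using wideal_diff[OF wideal_minus[OF eta] eps_eta] by simp
  qed
  have zero_mono: "f \<in> wideal n 0 \<Longrightarrow> f \<in> wideal n (\<gamma> ^ h)" for f :: "'a poly"
    by (erule wideal_dvd_mono) simp
  \<comment> \<open>The ideal generated by \<epsilon> and \<open>\<gamma>^h * \<delta>\<close>,
    described by components: zero along \<eta>, a multiple of \<open>\<gamma>^h\<close> along
    \<delta>, free along \<epsilon>.\<close>
  define I where "I = {a. a * \<eta> \<in> wideal n 0 \<and> a * \<delta> \<in> wideal n (\<gamma> ^ h)}"
  define C where "C = word_of n ` I"
  have I_mult: "f * a \<in> I" if "a \<in> I" for f a
    using that wideal_mult_left[OF n, of "a * \<eta>" 0 f] wideal_mult_left[OF n, of "a * \<delta>" "\<gamma> ^ h" f]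
    by (simp add: I_def mult.assoc)
  have I_add: "a + b \<in> I" if "a \<in> I" "b \<in> I" for a b
    using that by (simp add: I_def distrib_right wideal_add)
  have I_cong: "a \<in> I" if "b \<in> I" "word_of n a = word_of n b" for a b
  proof -
    have "a - b \<in> wideal n 0" using that(2) by (simp add: word_of_eq_iff[OF n] wcong_def)
    then have "(a - b) * f \<in> wideal n 0" for f by (rule wideal_mult_right[OF n])
    then have "a - b \<in> I" using zero_mono by (simp add: I_def)
    from I_add[OF this that(1)] show ?thesis by simp
  qed
  have C_iff: "word_of n a \<in> C \<longleftrightarrow> a \<in> I" for a
    unfolding C_def using I_cong by blast
  have C_words: "c \<in> C \<Longrightarrow> \<exists>a\<in>I. c = word_of n a" for c by (auto simp: C_def)
  have eps_I: "\<epsilon> \<in> I" using eps_eta zero_mono[OF eps_delta] by (simp add: I_def)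
  have delta_I: "smult (\<gamma> ^ h) \<delta> \<in> I"
    using wideal_smult[of "\<gamma> ^ h" "\<delta> * \<delta>" n] wideal_mult_left[OF n eta_delta, of "[:\<gamma> ^ h:]"]
    by (simp add: I_def mult.commute)
  have orth: "a * wstar n b \<in> wideal n 0" if ab: "a \<in> I" "b \<in> I" for a b
  proof -
    let ?b = "wstar n b"
    have b_eta: "?b * wstar n \<eta> \<in> wideal n 0"
      using wideal_wstar[OF n, of "b * \<eta>" 0] ab(2) by (simp add: I_def wstar_mult)
    have b_delta: "?b * wstar n \<delta> \<in> wideal n (\<gamma> ^ h)"
      using wideal_wstar[OF n, of "b * \<delta>" "\<gamma> ^ h"] ab(2) by (simp add: I_def wstar_mult)
    have "\<gamma> ^ h * \<gamma> ^ h = 0" using power_e e by (simp add: power_add)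
    then have "(a * \<delta>) * (?b * wstar n \<delta>) \<in> wideal n 0"
      using wideal_mult[OF n _ b_delta, of "a * \<delta>" "\<gamma> ^ h"] ab(1) by (simp add: I_def)
    moreover have "a * \<eta> \<in> wideal n 0" using ab(1) by (simp add: I_def)
    \<comment> \<open>This is \<open>a * ?b\<close> split along
      \<open>\<eta> + \<epsilon> + \<delta> = 1\<close>; the subtracted terms, zero in the quotient,
      remove the stars and the square of \<delta>.\<close>
    ultimately have "(a * \<eta>) * ?b + (a * (?b * wstar n \<eta>) - (a * ?b) * (wstar n \<eta> - \<epsilon>))
        + ((a * \<delta>) * (?b * wstar n \<delta>) - (a * ?b * \<delta>) * (wstar n \<delta> - \<delta>) - (a * ?b) * (\<delta> * \<delta> - \<delta>))
        \<in> wideal n 0" (is "?x \<in> _")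
      using b_eta star_eta star_delta delta
      by (simp only: wideal_add wideal_diff wideal_mult_left[OF n] wideal_mult_right[OF n])
    moreover have "?x = a * ?b * (\<eta> + \<epsilon> + \<delta>)"
      by (simp add: algebra_simps)
    moreover have "\<eta> + \<epsilon> + \<delta> = 1" by (simp add: \<delta>_def)
    ultimately show ?thesis by simp
  qed
  have code: "is_code n C"
    unfolding is_code_def
  proof (intro conjI ballI allI)
    show "C \<subseteq> words n" by (auto simp: C_def word_of_words)
    show "(\<lambda>_. 0) \<in> C"
      using C_iff[of 0] I_mult[OF eps_I, of 0] by (simp add: word_of_0)
    fix u assume "u \<in> C"
    then obtain a where a: "a \<in> I" "u = word_of n a" using C_words by blast
    show "(\<lambda>i. x * u i) \<in> C" for x
      using C_iff[of "smult x a"] I_mult[OF a(1), of "[:x:]"] by (simp add: a(2) word_of_smult)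
    fix v assume "v \<in> C"
    then obtain b where b: "b \<in> I" "v = word_of n b" using C_words by blast
    show "(\<lambda>i. u i + v i) \<in> C"
      using C_iff[of "a + b"] I_add[OF a(1) b(1)] by (simp add: a(2) b(2) word_of_add)
  qed
  have cyclic: "cyclic_code n C"
    unfolding cyclic_code_def
  proof (intro conjI ballI code)
    fix c assume "c \<in> C"
    then obtain a where a: "a \<in> I" "c = word_of n a" using C_words by blast
    show "cshift n c \<in> C"
      unfolding a(2) word_of_shift[OF n, symmetric] C_iff by (rule I_mult[OF a(1)])
  qed
  have "C \<subseteq> dual_code n C"
  proof
    fix u assume "u \<in> C"
    then obtain a where a: "a \<in> I" "u = word_of n a" using C_words by blast
    have "(\<Sum>i<n. u i * v i) = 0" if "v \<in> C" for v
    proof -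
      obtain b where b: "b \<in> I" "v = word_of n b" using \<open>v \<in> C\<close> C_words by blast
      show ?thesis
        using orth[OF a(1) b(1)] by (simp add: a(2) b(2) inner_word_of[OF n] wideal_def)
    qed
    then show "u \<in> dual_code n C" by (simp add: dual_code_def a(2) word_of_words)
  qed
  moreover have "dual_code n C \<subseteq> C"
  proof
    fix u assume u: "u \<in> dual_code n C"
    define a where "a = poly_of n u"
    have ua: "u = word_of n a"
      using u by (simp add: a_def dual_code_def word_of_poly_of)
    have *: "a * wstar n b \<in> wideal n 0" if "b \<in> I" for b
    proof -
      have "wrap n (a * wstar n b * wstar n (monom 1 m)) 0 = 0" for m
      proof -
        have "word_of n (monom 1 m * b) \<in> C" using I_mult[OF that] C_iff by blast
        then have "(\<Sum>i<n. word_of n a i * word_of n (monom 1 m * b) i) = 0"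
          using u by (simp add: dual_code_def ua)
        then show ?thesis
          unfolding inner_word_of[OF n] wstar_mult by (simp add: mult_ac)
      qed
      then show ?thesis using wideal_0_iff_shifts[OF n] by blast
    qed
    \<comment> \<open>Pairing with the generators \<epsilon> and
      \<open>\<gamma>^h * \<delta>\<close> returns the two conditions defining \<open>I\<close>;
      cancelling \<open>\<gamma>^h\<close> leaves divisibility by
      \<open>\<gamma>^(e-h) = \<gamma>^h\<close>.\<close>
    have "a * \<eta> \<in> wideal n 0" using *[OF eps_I] by (simp add: \<eta>_def)
    moreover have "a * \<delta> \<in> wideal n (\<gamma> ^ h)"
    proof (rule wideal_cancel)
      have "smult (\<gamma> ^ h) (a * wstar n \<delta>) \<in> wideal n 0" using *[OF delta_I] by (simp add: wstar_smult)
      moreover have "smult (\<gamma> ^ h) (a * \<delta>)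
          = smult (\<gamma> ^ h) (a * wstar n \<delta>) - smult (\<gamma> ^ h) a * (wstar n \<delta> - \<delta>)"
        by (simp add: algebra_simps smult_diff_right)
      ultimately show "smult (\<gamma> ^ h) (a * \<delta>) \<in> wideal n 0"
        by (simp only: wideal_diff wideal_mult_left[OF n star_delta])
      show "h + h \<le> e" using e by simp
    qed
    ultimately have "a \<in> I" by (simp add: I_def)
    then show "u \<in> C" using C_iff ua by simp
  qed
  ultimately have "self_dual n C" by (auto simp: self_dual_def)
  moreover have "C \<noteq> trivial_sd_code n \<gamma> e"
  proof
    assume "C = trivial_sd_code n \<gamma> e"
    then have "\<forall>i<n. \<gamma> ^ h dvd word_of n \<epsilon> i"
      using C_iff[of \<epsilon>] eps_I mem_trivial_sd_code[of "word_of n \<epsilon>" n \<gamma> e] by (simp add: h_def)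
    then have "\<epsilon> \<in> wideal n (\<gamma> ^ h)" by (simp add: wideal_iff[OF n])
    then have "\<epsilon> \<in> wideal n \<gamma>" by (rule wideal_dvd_mono) (use h_pos in simp)
    then show False using assms(5) by simp
  qed
  ultimately show ?thesis using cyclic by blast
qed

end

section \<open>The two cases: \<open>-1\<close> is, or is not, a power of \<open>p^r\<close> modulo
  \<open>n\<close>\<close>

context residue_reps
begin

text \<open>The exponent is congruent to \<open>n - 1\<close>, so Frobenius and the star substitute
  the same element for \<open>x\<close>.\<close>

lemma wstar_frobenius:
  assumes "n > 0" "int n dvd int ((p ^ r) ^ i) + 1"
  shows "wcong n \<gamma> (f ^ ((p ^ r) ^ i)) (wstar n f)"
proof -
  have "int ((p ^ r) ^ i) - int (n - 1) = (int ((p ^ r) ^ i) + 1) - int n"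
    using assms(1) by (simp add: of_nat_diff)
  then have "int n dvd int ((p ^ r) ^ i) - int (n - 1)"
    using assms(2) by (metis dvd_diff dvd_refl)
  then show ?thesis
    unfolding wstar_def
    using wcong_trans[OF frobenius[OF assms(1)] wcong_pcompose[OF assms(1) wcong_monom]] by blast
qed

text \<open>Modulo \<gamma>, \<open>u^(Q+1) = 0\<close> while applying the star twice gives
  \<open>u^(Q*Q) = u\<close>; as \<open>Q \<ge> 2\<close>, the second power is a multiple of the
  first.\<close>

lemma wideal_of_mult_wstar:
  assumes "n > 0" "i > 0" "int n dvd int ((p ^ r) ^ i) + 1" "u * wstar n u \<in> wideal n \<gamma>"
  shows "u \<in> wideal n \<gamma>"
proof -
  define Q where "Q = (p ^ r) ^ i"
  have Q: "Q \<ge> 2" using card_gt_1 assms(2) one_less_power[of "p ^ r" i] by (simp add: Q_def)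
  have star: "wcong n \<gamma> (f ^ Q) (wstar n f)" for f
    unfolding Q_def by (rule wstar_frobenius[OF assms(1,3)])
  have "wcong n \<gamma> (u * u ^ Q) (u * wstar n u)"
    by (intro wcong_mult assms(1) wcong_refl star)
  then have 1: "u * u ^ Q \<in> wideal n \<gamma>" using assms(4) wideal_wcong by blast
  have "2 * Q \<le> Q * Q" using Q by simp
  then have "Q + 1 \<le> Q * Q" using Q by linarith
  then have "u ^ (Q * Q) = (u * u ^ Q) * u ^ (Q * Q - (Q + 1))"
    by (metis le_add_diff_inverse power_add power_Suc Suc_eq_plus1)
  then have 2: "u ^ (Q * Q) \<in> wideal n \<gamma>" using wideal_mult_right[OF assms(1) 1] by simp
  have "wcong n \<gamma> ((u ^ Q) ^ Q) (wstar n u ^ Q)" by (rule wcong_power[OF assms(1) star])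
  also have "wcong n \<gamma> (wstar n u ^ Q) (wstar n (wstar n u))" by (rule star)
  also have "wcong n \<gamma> (wstar n (wstar n u)) u" by (rule wstar_wstar[OF assms(1)])
  finally have "wcong n \<gamma> u (u ^ (Q * Q))" by (simp add: power_mult wcong_sym)
  then show ?thesis using 2 by (rule wideal_wcong)
qed

lemma cyclic_self_dual_trivial:
  assumes "n > 0" "even e" "i > 0" "int n dvd int ((p ^ r) ^ i) + 1"
    and "cyclic_code n C" "self_dual n C"
  shows "C = trivial_sd_code n \<gamma> e"
proof -
  have C_words: "C \<subseteq> words n" using assms(5) by (simp add: cyclic_code_def is_code_def)
  have sub: "c \<in> trivial_sd_code n \<gamma> e" if c: "c \<in> C" for c
  proof -
    define f where "f = poly_of n c"
    have fc: "word_of n f = c" using c C_words word_of_poly_of by (auto simp: f_def)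
    have "j \<le> e div 2 \<Longrightarrow> f \<in> wideal n (\<gamma> ^ j)" for j
    proof (induction j)
      case 0
      then show ?case by (simp add: wideal_1)
    next
      case (Suc j)
      then have "f \<in> wideal n (\<gamma> ^ j)" by simp
      then obtain u where u: "wcong n 0 f (smult (\<gamma> ^ j) u)"
        using wideal_divide[OF assms(1)] by blast
      then have "word_of n (smult (\<gamma> ^ j) u) \<in> C" using c fc word_of_eq_iff[OF assms(1)] by metis
      from cyclic_self_dual_mult_wstar[OF assms(1,5,6) this this]
      have "smult (\<gamma> ^ (j + j)) (u * wstar n u) \<in> wideal n 0"
        by (simp add: wstar_smult power_add)
      \<comment> \<open>\<open>Suc j \<le> e div 2\<close> gives \<open>j + j + 1 \<le> e\<close>,
        so one factor \<gamma> survives the cancellation.\<close>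
      then have "u * wstar n u \<in> wideal n (\<gamma> ^ 1)" by (rule wideal_cancel) (use Suc.prems in simp)
      then have "u \<in> wideal n \<gamma>"
        unfolding power_one_right by (rule wideal_of_mult_wstar[OF assms(1,3,4)])
      then have "[:\<gamma> ^ j:] * u \<in> wideal n (\<gamma> ^ j * \<gamma>)"
        by (intro wideal_mult assms(1)) (use wideal_smult[of "\<gamma> ^ j" 1 n] in \<open>simp add: smult_one\<close>)
      then have "smult (\<gamma> ^ j) u \<in> wideal n (\<gamma> ^ Suc j)" by (simp add: mult.commute)
      moreover have "wcong n (\<gamma> ^ Suc j) f (smult (\<gamma> ^ j) u)"
        by (rule wcong_dvd_mono[OF u]) simp
      ultimately show ?case using wideal_wcong by blast
    qed
    then have "f \<in> wideal n (\<gamma> ^ (e div 2))" by simp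
    then show ?thesis
      using c C_words fc by (auto simp: mem_trivial_sd_code wideal_iff[OF assms(1)])
  qed
  \<comment> \<open>By the inclusion just shown, entries of both words are multiples of
    \<open>\<gamma>^(e/2)\<close>, so their products vanish; self-duality then returns
    \<open>c\<close> to \<open>C\<close>.\<close>
  moreover have "c \<in> C" if c: "c \<in> trivial_sd_code n \<gamma> e" for c
  proof -
    have "(\<Sum>i<n. c i * v i) = 0" if "v \<in> C" for v
    proof (rule sum.neutral, rule ballI)
      fix i assume "i \<in> {..<n}"
      then have "\<gamma> ^ (e div 2) * \<gamma> ^ (e div 2) dvd c i * v i"
        using c sub[OF that] by (intro mult_dvd_mono) (auto simp: mem_trivial_sd_code)
      moreover have "\<gamma> ^ (e div 2) * \<gamma> ^ (e div 2) = 0"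
        using assms(2) power_e by (metis power_add even_two_times_div_two mult_2)
      ultimately show "c i * v i = 0" by simp
    qed
    then have "c \<in> dual_code n C" using c by (simp add: dual_code_def mem_trivial_sd_code)
    then show ?thesis using assms(6) by (simp add: self_dual_def)
  qed
  ultimately show ?thesis by blast
qed

text \<open>If every candidate \<open>f c\<close> vanished modulo \<gamma>, then
  \<open>s - wstar n s\<close> would be unchanged by multiplication with each
  \<open>b c ^ q\<close>, hence with their product over \<open>S\<close>, which is zero.\<close>

lemma nonsymmetric_idempotent:
  assumes n: "n > 0" and s: "wcong n \<gamma> (s ^ (p ^ r)) s" and d: "s - wstar n s \<notin> wideal n \<gamma>"
  obtains f where "wcong n \<gamma> (f * f) f" "f * wstar n f \<in> wideal n \<gamma>" "f \<notin> wideal n \<gamma>"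
proof -
  \<comment> \<open>Here \<open>q\<close> is one less than the field size, so \<open>x^q\<close> is
    idempotent whenever \<open>x^(Suc q) = x\<close>.\<close>
  define q where "q = p ^ r - 1"
  have q: "p ^ r = Suc q" "q > 0" using card_gt_1 by (auto simp: q_def)
  define a where "a c = s - [:c:]" for c
  define b where "b c = wstar n (a c)" for c
  have b_eq: "b c = wstar n s - [:c:]" for c by (simp add: a_def b_def wstar_diff wstar_const)
  have a_frob: "wcong n \<gamma> (a c ^ Suc q) (a c)" for c
  proof -
    have a: "a c = s + [:- c:]" by (simp add: a_def poly_eq_iff coeff_pCons split: nat.split)
    have "a c ^ Suc q = (s + [:- c:]) ^ (p ^ r)" unfolding a q(1) ..
    also have "wcong n \<gamma> \<dots> (s ^ (p ^ r) + [:- c:] ^ (p ^ r))"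
      using wcong_freshman[where f = s and g = "[:- c:]" and i = 1] by simp
    also have "wcong n \<gamma> \<dots> (s + [:- c:])"
      unfolding poly_const_pow by (intro wcong_add s wcong_const fermat)
    finally show ?thesis unfolding a .
  qed
  have b_frob: "wcong n \<gamma> (b c ^ Suc q) (b c)" for c
    using wcong_wstar[OF n a_frob[of c]] by (simp only: b_def wstar_power)
  have idem: "x ^ q * (1 - x ^ q) \<in> wideal n \<gamma>" if "wcong n \<gamma> (x ^ Suc q) x" for x
  proof -
    have "x ^ q * (1 - x ^ q) = - (x ^ (q - 1) * (x ^ Suc q - x))"
      using q(2) by (cases q) (simp_all add: algebra_simps)
    moreover have "x ^ (q - 1) * (x ^ Suc q - x) \<in> wideal n \<gamma>"
      using that unfolding wcong_def by (rule wideal_mult_left[OF n])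
    ultimately show ?thesis using wideal_minus by simp
  qed
  \<comment> \<open>This is \<open>E * (1 - wstar n E)\<close> for
    \<open>E = 1 - a c ^ q\<close>.\<close>
  define f where "f c = (1 - a c ^ q) * b c ^ q" for c
  have f_idem: "wcong n \<gamma> (f c * f c) (f c)" for c
  proof -
    have "f c * f c - f c = - ((a c ^ q * (1 - a c ^ q)) * (b c ^ q * b c ^ q)
        + (1 - a c ^ q) * (b c ^ q * (1 - b c ^ q)))"
      by (simp add: f_def algebra_simps)
    then show ?thesis
      unfolding wcong_def
      using wideal_mult_right[OF n idem[OF a_frob]] wideal_mult_left[OF n idem[OF b_frob]]
      by (simp only: wideal_minus wideal_add)
  qed
  have f_star: "f c * wstar n (f c) \<in> wideal n \<gamma>" for c
  proof -
    have "f c * wstar n (f c)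
        = (1 - a c ^ q) * wstar n (b c) ^ q * (b c ^ q * (1 - b c ^ q))"
      by (simp add: f_def wstar_mult wstar_diff wstar_power mult_ac flip: b_def)
    then show ?thesis using wideal_mult_left[OF n idem[OF b_frob]] by simp
  qed
  have "\<exists>c. f c \<notin> wideal n \<gamma>"
  proof (rule ccontr)
    assume "\<not> ?thesis"
    then have f: "f c \<in> wideal n \<gamma>" for c by blast
    let ?d = "s - wstar n s"
    \<comment> \<open>Vanishing of \<open>f c\<close> gives \<open>b^q = a^q * b^q\<close>; the star
      of this relation gives \<open>a^q = a^q * b^q\<close>.\<close>
    have ab: "wcong n \<gamma> (b c ^ q) (a c ^ q)" for c
    proof -
      have 1: "wcong n \<gamma> (b c ^ q) (a c ^ q * b c ^ q)"
        using f[of c] by (simp add: wcong_def f_def algebra_simps)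
      have ss: "wcong n \<gamma> (wstar n (b c)) (a c)" unfolding b_def by (rule wstar_wstar[OF n])
      have "wcong n \<gamma> (a c ^ q) (wstar n (b c ^ q))"
        unfolding wstar_power by (intro wcong_power n wcong_sym[OF ss])
      also have "wcong n \<gamma> \<dots> (wstar n (a c ^ q * b c ^ q))" by (rule wcong_wstar[OF n 1])
      also have "\<dots> = b c ^ q * wstar n (b c) ^ q" by (simp add: wstar_mult wstar_power b_def)
      also have "wcong n \<gamma> \<dots> (b c ^ q * a c ^ q)"
        by (intro wcong_mult wcong_power n ss wcong_refl)
      finally have "wcong n \<gamma> (a c ^ q * b c ^ q) (a c ^ q)"
        by (simp add: mult.commute wcong_sym)
      with 1 show ?thesis by (rule wcong_trans)
    qed
    \<comment> \<open>The constant \<open>c\<close> cancels in \<open>a c - b c\<close>, so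
      \<open>?d\<close> is this difference for every \<open>c\<close>.\<close>
    have step: "wcong n \<gamma> (?d * b c ^ q) ?d" for c
    proof -
      have "?d * b c ^ q = a c * b c ^ q - b c ^ Suc q" by (simp add: b_eq a_def algebra_simps)
      also have "wcong n \<gamma> \<dots> (a c * a c ^ q - b c)"
        by (intro wcong_diff wcong_mult n wcong_refl ab b_frob)
      also have "wcong n \<gamma> \<dots> (a c - b c)"
        using a_frob[of c] by (intro wcong_diff wcong_refl) simp
      finally show ?thesis by (simp add: b_eq a_def)
    qed
    have "wcong n \<gamma> (?d * (\<Prod>c\<in>T. b c ^ q)) ?d" for T
    proof (induction T rule: infinite_finite_induct)
      case (insert c T)
      have "wcong n \<gamma> (?d * (\<Prod>c\<in>T. b c ^ q) * b c ^ q) (?d * b c ^ q)"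
        by (intro wcong_mult n insert.IH wcong_refl)
      from wcong_trans[OF this step] show ?case using insert.hyps by (simp add: mult_ac)
    qed simp_all
    then have "wcong n \<gamma> ?d (?d * (\<Prod>c\<in>S. b c) ^ q)"
      unfolding prod_power_distrib by (rule wcong_sym)
    moreover have "(\<Prod>c\<in>S. b c) \<in> wideal n \<gamma>"
    proof -
      have "wcong n \<gamma> (wstar n s ^ (p ^ r)) (wstar n s)"
        using wcong_wstar[OF n s] by (simp add: wstar_power)
      then show ?thesis unfolding b_eq by (rule wcong_prod_S[OF n])
    qed
    then have "(\<Prod>c\<in>S. b c) ^ q \<in> wideal n \<gamma>"
      using q(2) by (cases q) (auto intro: wideal_mult_right[OF n])
    ultimately have "?d \<in> wideal n \<gamma>" using wideal_wcong wideal_mult_left[OF n] by blast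
    then show False using d by simp
  qed
  then show ?thesis using that f_idem f_star by blast
qed

text \<open>Multiplication by \<open>q\<close> permutes the orbit of \<open>1\<close>, so Frobenius
  fixes \<open>s\<close>. The orbit contains \<open>1\<close> but not \<open>-1\<close>, so
  \<open>s\<close> and its star differ in the coefficient of \<open>x\<close>.\<close>

lemma cyclotomic_orbit_sum:
  assumes n: "n > 0" and cop: "coprime n p"
    and neg: "\<And>i. i > 0 \<Longrightarrow> \<not> int n dvd int ((p ^ r) ^ i) + 1"
  obtains s where "wcong n \<gamma> (s ^ (p ^ r)) s" "s - wstar n s \<notin> wideal n \<gamma>"
proof -
  define q where "q = p ^ r"
  have cop_q: "coprime (q ^ k) n" for k using cop by (simp add: q_def coprime_commute)
  \<comment> \<open>For \<open>n = 1\<close> every integer is congruent to \<open>-1\<close>,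
    contradicting \<open>neg\<close>.\<close>
  have n1: "n > 1" using neg[of 1] n by (cases "n = 1") auto
  define H where "H = (\<lambda>i. q ^ i mod n) ` UNIV"
  have H_less: "h < n" if "h \<in> H" for h using that n by (auto simp: H_def)
  then have finH: "finite H" by (meson finite_nat_set_iff_bounded)
  define s :: "'a poly" where "s = (\<Sum>h\<in>H. monom 1 h)"
  let ?\<phi> = "\<lambda>h. q * h mod n"
  have inj: "inj_on ?\<phi> H"
  proof (rule inj_onI)
    fix h h' assume h: "h \<in> H" "h' \<in> H" "q * h mod n = q * h' mod n"
    then have "[h = h'] (mod n)"
      using cop_q[of 1] cong_mult_lcancel_nat[of q n h h'] by (simp add: cong_def)
    then show "h = h'" using H_less h by (simp add: cong_def)
  qed
  have "?\<phi> h \<in> H" if h: "h \<in> H" for h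
  proof -
    obtain i where "h = q ^ i mod n" using h by (auto simp: H_def)
    then have "?\<phi> h = q ^ Suc i mod n" by (simp add: mod_mult_right_eq)
    then show ?thesis unfolding H_def by blast
  qed
  then have surj: "?\<phi> ` H = H" using inj finH by (intro endo_inj_surj) auto
  have "wcong n \<gamma> (s ^ (p ^ r)) (pcompose s (monom 1 q))"
    using frobenius[OF n, of s 1] by (simp add: q_def)
  also have "pcompose s (monom 1 q) = (\<Sum>h\<in>H. monom 1 (q * h))"
    by (simp add: s_def pcompose_sum pcompose_monom_1 monom_power)
  also have "wcong n \<gamma> \<dots> (\<Sum>h\<in>H. monom 1 (?\<phi> h))"
    by (intro wcong_sum wcong_monom) (simp add: zmod_int)
  also have "(\<Sum>h\<in>H. monom 1 (?\<phi> h)) = s"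
    unfolding s_def using sum.reindex[OF inj, of "monom (1::'a)"] surj by simp
  finally have frob: "wcong n \<gamma> (s ^ (p ^ r)) s" .
  \<comment> \<open>The pigeonhole principle and cancellation give a positive period of the powers
    of \<open>q\<close>.\<close>
  have "\<not> inj (\<lambda>i. q ^ i mod n)"
    using finH finite_imageD[of "\<lambda>i. q ^ i mod n" UNIV] by (auto simp: H_def)
  then obtain i j where ij: "i < j" "q ^ i mod n = q ^ j mod n"
    unfolding inj_def by (metis linorder_neqE_nat)
  then have "[q ^ i * q ^ (j - i) = q ^ i * 1] (mod n)"
    by (simp add: cong_def flip: power_add)
  then have period: "q ^ (j - i) mod n = 1"
    using cong_mult_lcancel_nat[OF cop_q, of i "q ^ (j - i)" 1] n1 by (simp add: cong_def)
  have not_neg: "\<not> int n dvd - 1 - int h" if h: "h \<in> H" for h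
  proof
    assume *: "int n dvd - 1 - int h"
    obtain k where "h = q ^ k mod n" using h by (auto simp: H_def)
    \<comment> \<open>\<open>neg\<close> speaks of positive exponents only, so exponent
      \<open>0\<close> is replaced by the period.\<close>
    moreover define l where "l = (if k = 0 then j - i else k)"
    ultimately have "h = q ^ l mod n" using period n1 by auto
    then have "int h = int (q ^ l) mod int n" by (simp add: zmod_int)
    moreover have "int n dvd int h + 1"
      using * dvd_minus_iff[of "int n" "- 1 - int h"] by (simp add: add.commute)
    ultimately have "int n dvd int (q ^ l) + 1"
      by (simp add: dvd_eq_mod_eq_0 mod_add_left_eq)
    moreover have "l > 0" using ij by (simp add: l_def)
    ultimately show False using neg[of l] by (simp add: q_def)
  qed
  have "1 \<in> H" using n1 by (auto simp: H_def image_iff intro!: exI[of _ 0])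
  have "int n dvd 1 - int h \<longleftrightarrow> h = 1" if "h \<in> H" for h
    using H_less[OF that] n1 mod_eq_dvd_iff[of 1 "int n" "int h"] by auto
  then have "wrap n s 1 = (\<Sum>h\<in>H. if h = 1 then 1 else 0)"
    unfolding s_def wrap_sum wrap_monom by (intro sum.cong) simp_all
  also have "\<dots> = 1" using finH \<open>1 \<in> H\<close> by simp
  finally have "wrap n s 1 = 1" .
  moreover have "wrap n s (- 1) = 0"
    unfolding s_def wrap_sum wrap_monom using not_neg by (intro sum.neutral) simp
  ultimately have "wrap n (s - wstar n s) 1 = 1"
    by (simp add: wrap_diff wrap_wstar[OF n])
  then have "s - wstar n s \<notin> wideal n \<gamma>" using not_dvd_1
    unfolding wideal_def by (metis mem_Collect_eq)
  with frob show ?thesis by (rule that)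
qed

text \<open>Lifting controls \<open>g * wstar n g\<close> only modulo \<gamma>, but this product is
  itself idempotent and therefore zero.\<close>

lemma nontrivial_self_dual_exists:
  assumes n: "n > 0" and "even e" "coprime n p"
    and "\<And>i. i > 0 \<Longrightarrow> \<not> int n dvd int ((p ^ r) ^ i) + 1"
  shows "\<exists>C. cyclic_code n C \<and> self_dual n C \<and> C \<noteq> trivial_sd_code n \<gamma> e"
proof -
  obtain s where "wcong n \<gamma> (s ^ (p ^ r)) s" "s - wstar n s \<notin> wideal n \<gamma>"
    using cyclotomic_orbit_sum assms by blast
  then obtain f where f: "wcong n \<gamma> (f * f) f" "f * wstar n f \<in> wideal n \<gamma>" "f \<notin> wideal n \<gamma>"
    using nonsymmetric_idempotent[OF n] by blast
  obtain g where g: "wcong n \<gamma> g f" "wcong n 0 (g * g) g"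
    using lift_idempotent[OF n f(1)] by blast
  have "wcong n \<gamma> (g * wstar n g) (f * wstar n f)"
    by (intro wcong_mult wcong_wstar n g(1))
  then have "g * wstar n g \<in> wideal n \<gamma>" using f(2) by (rule wideal_wcong)
  moreover have "wcong n 0 (g * wstar n g * (g * wstar n g)) (g * wstar n g)"
    using wcong_mult[OF n g(2) wcong_wstar[OF n g(2)]] by (simp add: wstar_mult mult_ac)
  ultimately have "g * wstar n g \<in> wideal n 0" using idempotent_wideal[OF n] by blast
  moreover have "g \<notin> wideal n \<gamma>" using f(3) g(1) wcong_sym wideal_wcong by blast
  ultimately show ?thesis using self_dual_code_of_idempotent[OF n assms(2) g(2)] by blast
qed

end

theorem mainTheorem7:
  fixes \<gamma> :: "'a::comm_ring_1" and e p r n :: nat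
  assumes "chain_ring TYPE('a)"
    and "{x::'a. \<not> x dvd 1} = pideal \<gamma>"
    and "\<gamma> ^ e = 0" and "\<gamma> ^ (e - 1) \<noteq> 0" and "even e"
    and "prime p" and "card (residue_field \<gamma>) = p ^ r"
    and "n > 0" and "coprime n p"
  shows "(\<exists>C :: (nat \<Rightarrow> 'a) set. cyclic_code n C \<and> self_dual n C \<and> C \<noteq> trivial_sd_code n \<gamma> e)
     \<longleftrightarrow> (\<forall>i::nat. i > 0 \<longrightarrow> \<not> [int ((p ^ r) ^ i) = -1] (mod int n))"
proof -
  have "card (residue_field \<gamma>) > 0" using assms(6,7) prime_gt_0_nat by simp
  then obtain S where S: "finite S" "card S = card (residue_field \<gamma>)"
    "\<And>c d. c \<in> S \<Longrightarrow> d \<in> S \<Longrightarrow> \<gamma> dvd c - d \<Longrightarrow> c = d" "\<And>x. \<exists>c\<in>S. \<gamma> dvd x - c"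
    using residue_field_reps by blast
  have nonunit: "\<not> x dvd 1 \<longleftrightarrow> \<gamma> dvd x" for x
  proof -
    have "\<not> x dvd 1 \<longleftrightarrow> x \<in> pideal \<gamma>" using assms(2) by blast
    then show ?thesis by (auto simp: pideal_def dvd_def mult.commute)
  qed
  interpret residue_reps \<gamma> e p r S
    by unfold_locales (use assms S nonunit in auto)
  have cong: "[int ((p ^ r) ^ i) = -1] (mod int n) \<longleftrightarrow> int n dvd int ((p ^ r) ^ i) + 1" for i
    by (simp add: cong_iff_dvd_diff)
  show ?thesis
    unfolding cong
    using cyclic_self_dual_trivial[OF assms(8,5)] nontrivial_self_dual_exists[OF assms(8,5,9)]
    by blast
qed

end
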